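(* There exists a nonsequenceable Steiner triple system of order $n$ for all $n\equiv 1 \pmod 6$ except for $n=7$ (for $n=7$, no nonsequenceable Steiner triple system of order $7$ exists).
   Context: A Steiner triple system of order $n$ is a pair $(X,B)$, where $X$ is an $n$-element set of points and $B$ is a collection of $3$-element subsets of $X$ called blocks, such that every pair of distinct points is contained in exactly one block. A sequencing of $(X,B)$ is an ordering $x_1x_2\cdots x_n$ of all the points of $X$, each appearing exactly once. A proper segment is a nonempty set of consecutive terms $x_i x_{i+1}\cdots x_j$ ($1\le i\le j\le n$) that is not the whole sequence. A segment can be partitioned into blocks if its set of points is a disjoint union of blocks in $B$. The system is sequenceable if there is a sequencing in which no proper segment can be partitioned into blocks; such a sequence is called admissible. The system is nonsequenceable if it has no admissible sequence.
   Formalization: The order n = 1 is excluded as well as n = 7: the one-point system with no blocks has only one sequencing and no proper segment, so it is sequenceable and the claim fails for n = 1. *)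

theory Defs
  imports Main "HOL-Library.Sublist" "HOL-Library.Disjoint_Sets" "HOL-Number_Theory.Cong"
begin

definition steiner_triple_system :: "nat \<Rightarrow> 'a set \<Rightarrow> 'a set set \<Rightarrow> bool" where
  "steiner_triple_system n X B \<longleftrightarrow>
     finite X \<and> card X = n \<and>
     (\<forall>b\<in>B. b \<subseteq> X \<and> card b = 3) \<and>
     (\<forall>x\<in>X. \<forall>y\<in>X. x \<noteq> y \<longrightarrow> (\<exists>!b. b \<in> B \<and> x \<in> b \<and> y \<in> b))"

definition sequencing :: "'a set \<Rightarrow> 'a list \<Rightarrow> bool" where
  "sequencing X xs \<longleftrightarrow> distinct xs \<and> set xs = X"

(* sublist of HOL-Library.Sublist means a contiguous factor of the list. *)
definition proper_segment :: "'a list \<Rightarrow> 'a list \<Rightarrow> bool" where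
  "proper_segment ys xs \<longleftrightarrow> ys \<noteq> [] \<and> strict_sublist ys xs"

definition partitionable_into_blocks :: "'a set set \<Rightarrow> 'a list \<Rightarrow> bool" where
  "partitionable_into_blocks B ys \<longleftrightarrow> (\<exists>P\<subseteq>B. partition_on (set ys) P)"

definition admissible :: "'a set \<Rightarrow> 'a set set \<Rightarrow> 'a list \<Rightarrow> bool" where
  "admissible X B xs \<longleftrightarrow>
     sequencing X xs \<and> (\<forall>ys. proper_segment ys xs \<longrightarrow> \<not> partitionable_into_blocks B ys)"

definition sequenceable :: "'a set \<Rightarrow> 'a set set \<Rightarrow> bool" where
  "sequenceable X B \<longleftrightarrow> (\<exists>xs. admissible X B xs)"

abbreviation nonsequenceable :: "'a set \<Rightarrow> 'a set set \<Rightarrow> bool" where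
  "nonsequenceable X B \<equiv> \<not> sequenceable X B"

(* The one-point system (order 1, no blocks) is vacuously sequenceable, since its
   sequencing has no proper segment. Statements about all orders congruent to 1
   modulo 6 therefore concern the nontrivial orders n > 1. *)

end

theory Submission
  imports Defs
begin

text \<open>
  Suppose that for every point \<open>x\<close> of a Steiner triple system the remaining points split into
  disjoint blocks (an almost parallel class missing \<open>x\<close>). Deleting the first term of any
  sequencing then leaves a proper segment that can be partitioned into blocks, so the system is
  nonsequenceable. The positive half of the theorem therefore follows once such systems exist for
  every order \<open>6 * k + 1\<close> with \<open>k \<ge> 2\<close>, which is \<open>almost_parallel_order_6k_plus_1\<close>, by
  strong induction on \<open>k\<close>.

  The property passes through filled group divisible designs. Add one new point \<open>\<omega>\<close> to the
  points of a 3-GDD and place on each group together with \<open>\<omega>\<close> a system that has all almost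
  parallel classes. An almost parallel class missing \<open>z\<close> is obtained group by group, without any
  block of the GDD: the group of \<open>z\<close> contributes the class missing \<open>z\<close>, which covers \<open>\<omega>\<close>,
  and every other group contributes its class missing \<open>\<omega>\<close> (\<open>almost_parallel_sts_fill\<close>).

  It remains to supply GDDs with unequal groups, for otherwise prime \<open>k\<close> could not be reached.
  For odd \<open>a\<close> the lines \<open>(x, x + d, x + 2 * d; d)\<close> modulo \<open>a\<close> form a transversal design with
  four groups of size \<open>a\<close>. Truncate the last group to the \<open>d\<close> below some \<open>b \<le> a\<close> and replace
  every point by two. A line of three points becomes a Latin square of order two, and a line of
  four points becomes the affine plane of order three without one of its points, whose eight
  remaining points form four groups of size two. With \<open>a = 3 * m\<close> and \<open>b = 3 * r\<close> the group sizes
  are \<open>6 * m\<close> three times and \<open>6 * r\<close>, which gives the step from \<open>m\<close> and \<open>r\<close> to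
  \<open>3 * m + r\<close> (\<open>almost_parallel_order_step\<close>).

  The values of \<open>k\<close> that this step does not reach are handled by explicit cyclic systems
  (\<open>cyclic_almost_parallel_sts\<close>). Translations act transitively there, so a single almost
  parallel class, missing 0, suffices, and both the difference family and the class are checked
  by computation.

  In order 7 any two blocks meet, so a proper segment can only be partitioned into blocks if it is
  itself a block of three consecutive terms. The three blocks through a point \<open>d\<close>, matched up by
  one block that avoids \<open>d\<close>, suggest an ordering without such a segment (\<open>sequencing_of_order_7\<close>).
\<close>

section \<open>Almost parallel classes obstruct sequencings\<close>

lemma steiner_triple_systemD:
  assumes "steiner_triple_system n X B"
  shows "finite X" and "card X = n"
    and "b \<in> B \<Longrightarrow> b \<subseteq> X" and "b \<in> B \<Longrightarrow> card b = 3"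
    and "x \<in> X \<Longrightarrow> y \<in> X \<Longrightarrow> x \<noteq> y \<Longrightarrow> \<exists>!b. b \<in> B \<and> x \<in> b \<and> y \<in> b"
proof -
  note sts = assms[unfolded steiner_triple_system_def]
  show "finite X" "card X = n" "b \<in> B \<Longrightarrow> b \<subseteq> X" "b \<in> B \<Longrightarrow> card b = 3"
    using sts by simp_all
  have "\<forall>x\<in>X. \<forall>y\<in>X. x \<noteq> y \<longrightarrow> (\<exists>!b. b \<in> B \<and> x \<in> b \<and> y \<in> b)"
    using sts by (elim conjE)
  then show "x \<in> X \<Longrightarrow> y \<in> X \<Longrightarrow> x \<noteq> y \<Longrightarrow> \<exists>!b. b \<in> B \<and> x \<in> b \<and> y \<in> b"
    by (elim ballE impE) auto
qed

definition almost_parallel_sts :: "nat \<Rightarrow> 'a set \<Rightarrow> 'a set set \<Rightarrow> bool" where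
  "almost_parallel_sts n X B \<longleftrightarrow>
     steiner_triple_system n X B \<and> (\<forall>x\<in>X. \<exists>P\<subseteq>B. partition_on (X - {x}) P)"

text \<open>The orders of such systems. Requiring the points to be natural numbers keeps the predicate free of
  a point type; systems on other types are moved there along an injection.\<close>
definition almost_parallel_order :: "nat \<Rightarrow> bool" where
  "almost_parallel_order n \<longleftrightarrow> (\<exists>(X :: nat set) B. almost_parallel_sts n X B)"

text \<open>The tail of a sequencing omits exactly one point, so it is a union of disjoint blocks; it is a
  nonempty segment as soon as there are two points.\<close>
lemma nonsequenceable_if_almost_parallel:
  assumes "almost_parallel_sts n X B" and "n > 1"
  shows "nonsequenceable X B"
proof
  assume "sequenceable X B"
  then obtain xs where adm: "admissible X B xs"
    by (auto simp: sequenceable_def)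
  then have dist: "distinct xs" and X: "set xs = X"
    by (auto simp: admissible_def sequencing_def)
  have "length xs = n"
    using assms(1) dist X distinct_card[OF dist]
    by (simp add: almost_parallel_sts_def steiner_triple_system_def)
  then obtain x y ys where xs: "xs = x # y # ys"
    using \<open>n > 1\<close> by (cases xs; cases "tl xs") auto
  have "set (y # ys) = X - {x}" "x \<in> X"
    using dist X xs by auto
  then have "partitionable_into_blocks B (y # ys)"
    using assms(1) by (auto simp: almost_parallel_sts_def partitionable_into_blocks_def)
  moreover have "sublist (y # ys) xs"
    unfolding xs sublist_def by (metis append.left_neutral append_Cons append_Nil2)
  then have "proper_segment (y # ys) xs"
    by (auto simp: proper_segment_def strict_sublist_def xs)
  ultimately show False
    using adm by (auto simp: admissible_def)
qed

lemma steiner_triple_system_image: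
  assumes sts: "steiner_triple_system n X B" and inj: "inj_on f X"
  shows "steiner_triple_system n (f ` X) ((`) f ` B)"
proof -
  have BX: "b \<subseteq> X" "card b = 3" if "b \<in> B" for b
    using steiner_triple_systemD(3,4)[OF sts that] .
  have mem: "f x \<in> f ` b \<longleftrightarrow> x \<in> b" if "x \<in> X" "b \<in> B" for x b
    by (rule inj_on_image_mem_iff[OF inj that(1) BX(1)[OF that(2)]])
  have pair: "\<exists>!c. c \<in> (`) f ` B \<and> f x \<in> c \<and> f y \<in> c"
    if xy: "x \<in> X" "y \<in> X" "f x \<noteq> f y" for x y
  proof -
    have "\<exists>!b. b \<in> B \<and> x \<in> b \<and> y \<in> b"
      using xy by (intro steiner_triple_systemD(5)[OF sts]) auto
    then obtain b where b: "b \<in> B" "x \<in> b" "y \<in> b"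
      and uniq: "\<And>b'. b' \<in> B \<Longrightarrow> x \<in> b' \<Longrightarrow> y \<in> b' \<Longrightarrow> b' = b"
      by blast
    show ?thesis
    proof (rule ex1I[of _ "f ` b"])
      show "f ` b \<in> (`) f ` B \<and> f x \<in> f ` b \<and> f y \<in> f ` b"
        using b by simp
    next
      fix c assume c: "c \<in> (`) f ` B \<and> f x \<in> c \<and> f y \<in> c"
      then obtain b' where b': "b' \<in> B" "c = f ` b'"
        by blast
      then have "x \<in> b'" "y \<in> b'"
        using c mem[OF xy(1) b'(1)] mem[OF xy(2) b'(1)] by simp_all
      then show "c = f ` b"
        using uniq[OF b'(1)] b'(2) by simp
    qed
  qed
  have block: "f ` b \<subseteq> f ` X \<and> card (f ` b) = 3" if "b \<in> B" for b
    using BX[OF that] card_image[OF inj_on_subset[OF inj BX(1)[OF that]]] by auto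
  show ?thesis
    unfolding steiner_triple_system_def
  proof (intro conjI ballI impI)
    fix u v assume "u \<in> f ` X" "v \<in> f ` X" "u \<noteq> v"
    then obtain x y where "x \<in> X" "y \<in> X" "u = f x" "v = f y"
      by blast
    with \<open>u \<noteq> v\<close> show "\<exists>!c. c \<in> (`) f ` B \<and> u \<in> c \<and> v \<in> c"
      using pair[of x y] by metis
  next
    show "card (f ` X) = n" "finite (f ` X)"
      using steiner_triple_systemD(1,2)[OF sts] card_image[OF inj] finite_imageI by metis+
  next
    fix c assume "c \<in> (`) f ` B"
    then show "c \<subseteq> f ` X" "card c = 3"
      using block by blast+
  qed
qed

lemma partition_on_image:
  assumes "partition_on A P" and "inj_on f A"
  shows "partition_on (f ` A) ((`) f ` P)"
proof -
  have "{} \<notin> (`) f ` P"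
    using partition_onD3[OF assms(1)] by auto
  then show ?thesis
    using partition_on_inj_image[OF assms] by simp
qed

lemma almost_parallel_sts_image:
  assumes ap: "almost_parallel_sts n X B" and inj: "inj_on f X"
  shows "almost_parallel_sts n (f ` X) ((`) f ` B)"
proof -
  have "\<exists>Q\<subseteq>(`) f ` B. partition_on (f ` X - {f x}) Q" if x: "x \<in> X" for x
  proof -
    obtain P where P: "P \<subseteq> B" "partition_on (X - {x}) P"
      using ap x by (auto simp: almost_parallel_sts_def)
    have "partition_on (f ` (X - {x})) ((`) f ` P)"
      using P(2) inj by (intro partition_on_image) (auto intro: inj_on_subset)
    moreover have "f ` (X - {x}) = f ` X - {f x}"
      using inj x by (auto simp: inj_on_def)
    ultimately show ?thesis
      using P(1) by (metis image_mono)
  qed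
  then show ?thesis
    using ap steiner_triple_system_image[OF _ inj] by (auto simp: almost_parallel_sts_def)
qed

lemma almost_parallel_orderI:
  assumes "almost_parallel_sts n X B"
  shows "almost_parallel_order n"
proof -
  have "finite X"
    using assms by (auto simp: almost_parallel_sts_def steiner_triple_system_def)
  then obtain f :: "'a \<Rightarrow> nat" where "inj_on f X"
    by (metis finite_imp_inj_to_nat_seg)
  then show ?thesis
    using almost_parallel_sts_image[OF assms] by (auto simp: almost_parallel_order_def)
qed

lemma almost_parallel_order_on:
  assumes "almost_parallel_order n" and "finite Y" "card Y = n"
  shows "\<exists>B. almost_parallel_sts n Y B"
proof -
  obtain X :: "nat set" and B where ap: "almost_parallel_sts n X B"
    using assms(1) by (auto simp: almost_parallel_order_def)
  then have "finite X" "card X = n"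
    by (simp_all add: almost_parallel_sts_def steiner_triple_system_def)
  then obtain f where f: "bij_betw f X Y"
    using assms(2,3) finite_same_card_bij[of X Y] by auto
  then have "almost_parallel_sts n Y ((`) f ` B)"
    using almost_parallel_sts_image[OF ap, of f] by (simp add: bij_betw_def)
  then show ?thesis
    by blast
qed

section \<open>Filling the groups of a group divisible design\<close>

text \<open>A group divisible design with block size three: pairs within a group are covered by no block,
  all other pairs by exactly one. The groups may have different sizes.\<close>
definition triple_gdd :: "'a set \<Rightarrow> 'a set set \<Rightarrow> 'a set set \<Rightarrow> bool" where
  "triple_gdd Z G D \<longleftrightarrow>
     finite Z \<and> partition_on Z G \<and> (\<forall>b\<in>D. b \<subseteq> Z \<and> card b = 3) \<and>
     (\<forall>x\<in>Z. \<forall>y\<in>Z. x \<noteq> y \<longrightarrow>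
        (if \<exists>g\<in>G. x \<in> g \<and> y \<in> g then \<not> (\<exists>b\<in>D. x \<in> b \<and> y \<in> b)
         else \<exists>!b. b \<in> D \<and> x \<in> b \<and> y \<in> b))"

lemma partition_on_Union:
  assumes part: "\<And>g. g \<in> G \<Longrightarrow> partition_on (S g) (P g)"
    and disj: "\<And>g h. g \<in> G \<Longrightarrow> h \<in> G \<Longrightarrow> g \<noteq> h \<Longrightarrow> S g \<inter> S h = {}"
  shows "partition_on (\<Union>g\<in>G. S g) (\<Union>g\<in>G. P g)"
proof -
  have U: "\<Union>(P g) = S g" if "g \<in> G" for g
    using partition_onD1[OF part[OF that]] by simp
  have "disjoint (\<Union>g\<in>G. P g)"
  proof (rule disjoint_UN)
    show "disjoint (P g)" if "g \<in> G" for g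
      using part[OF that] by (rule partition_onD2)
    show "disjoint_family_on (\<lambda>g. \<Union>(P g)) G"
      using U disj by (auto simp: disjoint_family_on_def)
  qed
  moreover have "{} \<notin> (\<Union>g\<in>G. P g)"
    using part partition_onD3 by fastforce
  moreover have "\<Union>(\<Union>g\<in>G. P g) = (\<Union>g\<in>G. \<Union>(P g))"
    by blast
  then have "\<Union>(\<Union>g\<in>G. P g) = (\<Union>g\<in>G. S g)"
    using U by simp
  ultimately show ?thesis
    by (simp add: partition_on_def)
qed

text \<open>Two points of one group, or \<open>\<omega>\<close> and a point, lie in a common filled group and in no other, so
  their block comes from the system on that group; points of different groups only meet in a block
  of the GDD.\<close>
lemma steiner_triple_system_fill:
  assumes gdd: "triple_gdd Z G D" and inf: "\<omega> \<notin> Z"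
    and C: "\<And>g. g \<in> G \<Longrightarrow> steiner_triple_system (card g + 1) (insert \<omega> g) (C g)"
  shows "steiner_triple_system (card Z + 1) (insert \<omega> Z) (D \<union> (\<Union>g\<in>G. C g))"
proof -
  have fin: "finite Z" and part: "partition_on Z G"
    and D: "\<And>b. b \<in> D \<Longrightarrow> b \<subseteq> Z \<and> card b = 3"
    using gdd by (auto simp: triple_gdd_def)
  have Z: "Z = \<Union>G"
    using part by (rule partition_onD1)
  have disj: "g = h" if "g \<in> G" "h \<in> G" "x \<in> g" "x \<in> h" for g h x
    using partition_onD2[OF part] that by (auto simp: disjoint_def)
  have Cb: "b \<subseteq> insert \<omega> g" "card b = 3" if "g \<in> G" "b \<in> C g" for g b
    using steiner_triple_systemD(3,4)[OF C[OF that(1)] that(2)] .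
  have grp: "\<exists>!b. b \<in> C g \<and> x \<in> b \<and> y \<in> b"
    if "g \<in> G" "x \<in> insert \<omega> g" "y \<in> insert \<omega> g" "x \<noteq> y" for g x y
    using steiner_triple_systemD(5)[OF C[OF that(1)] that(2-)] .
  let ?B = "D \<union> (\<Union>g\<in>G. C g)"
  have "\<exists>!b. b \<in> ?B \<and> x \<in> b \<and> y \<in> b"
    if xy: "x \<in> insert \<omega> Z" "y \<in> insert \<omega> Z" "x \<noteq> y" for x y
  proof (cases "\<exists>g\<in>G. x \<in> insert \<omega> g \<and> y \<in> insert \<omega> g")
    case True
    then obtain g where g: "g \<in> G" "x \<in> insert \<omega> g" "y \<in> insert \<omega> g"
      by blast
    obtain b where b: "b \<in> C g" "x \<in> b" "y \<in> b"
      and uniq: "\<And>b'. b' \<in> C g \<Longrightarrow> x \<in> b' \<Longrightarrow> y \<in> b' \<Longrightarrow> b' = b"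
      using grp[OF g xy(3)] by blast
    show ?thesis
    proof (rule ex1I[of _ b])
      show "b \<in> ?B \<and> x \<in> b \<and> y \<in> b"
        using b g(1) by auto
    next
      fix b' assume b': "b' \<in> ?B \<and> x \<in> b' \<and> y \<in> b'"
      have "b' \<notin> D"
      proof
        assume "b' \<in> D"
        then have "x \<in> Z" "y \<in> Z"
          using D b' by auto
        then have "x \<in> g" "y \<in> g"
          using g inf by auto
        then show False
          using gdd \<open>x \<in> Z\<close> \<open>y \<in> Z\<close> \<open>b' \<in> D\<close> b' g(1) xy(3)
          unfolding triple_gdd_def by metis
      qed
      then obtain h where h: "h \<in> G" "b' \<in> C h"
        using b' by auto
      then have "x \<in> insert \<omega> h" "y \<in> insert \<omega> h"
        using Cb b' by auto
      then have "g = h"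
        using disj[OF g(1) h(1)] g xy(3) by auto
      then show "b' = b"
        using uniq h b' by auto
    qed
  next
    case False
    obtain g h where gh: "g \<in> G" "x \<in> insert \<omega> g" "h \<in> G" "y \<in> insert \<omega> h"
    proof -
      have "x \<noteq> \<omega> \<or> y \<noteq> \<omega>"
        using xy by auto
      then obtain g where "g \<in> G"
        using xy Z by auto
      then have "x \<noteq> \<omega>" "y \<noteq> \<omega>"
        using False xy Z by auto
      then show ?thesis
        using that xy Z by auto
    qed
    have Zxy: "x \<in> Z" "y \<in> Z"
      using False gh xy by auto
    have "\<not> (\<exists>g\<in>G. x \<in> g \<and> y \<in> g)"
      using False by auto
    then have "\<exists>!b. b \<in> D \<and> x \<in> b \<and> y \<in> b"
      using gdd Zxy xy(3) unfolding triple_gdd_def by metis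
    moreover have "\<not> (x \<in> b \<and> y \<in> b)" if "g \<in> G" "b \<in> C g" for b g
      using Cb[OF that] False that(1) by auto
    ultimately show ?thesis
      by blast
  qed
  moreover have "b \<subseteq> insert \<omega> Z \<and> card b = 3" if "b \<in> ?B" for b
    using that D Cb Z by fastforce
  ultimately show ?thesis
    using fin inf by (simp add: steiner_triple_system_def)
qed

text \<open>The sets \<open>insert \<omega> g\<close> overlap only in \<open>\<omega>\<close>. If each of them loses \<open>\<omega>\<close>, except that
  the one containing the omitted point loses that point instead, they become disjoint and cover
  everything but the omitted point. The almost parallel classes of the groups then fit together.\<close>
lemma almost_parallel_sts_fill:
  assumes gdd: "triple_gdd Z G D" and inf: "\<omega> \<notin> Z"
    and C: "\<And>g. g \<in> G \<Longrightarrow> almost_parallel_sts (card g + 1) (insert \<omega> g) (C g)"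
  shows "almost_parallel_sts (card Z + 1) (insert \<omega> Z) (D \<union> (\<Union>g\<in>G. C g))"
proof -
  have part: "partition_on Z G"
    using gdd by (auto simp: triple_gdd_def)
  have Z: "Z = \<Union>G"
    using part by (rule partition_onD1)
  have disj: "g \<inter> h = {}" if "g \<in> G" "h \<in> G" "g \<noteq> h" for g h
    using partition_onD2[OF part] that by (auto simp: disjoint_def)
  have "\<exists>P\<subseteq>\<Union>g\<in>G. C g. partition_on (insert \<omega> Z - {z}) P" if z: "z \<in> insert \<omega> Z" for z
  proof -
    \<comment> \<open>Every group avoids the new point, except that the group of the omitted point
      exchanges that point for the new one.\<close>
    define t where "t g = (if z \<in> g then z else \<omega>)" for g
    have "\<exists>P\<subseteq>C g. partition_on (insert \<omega> g - {t g}) P" if "g \<in> G" for g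
      using C[OF that] by (auto simp: almost_parallel_sts_def t_def)
    then obtain P where P: "\<And>g. g \<in> G \<Longrightarrow> P g \<subseteq> C g"
      "\<And>g. g \<in> G \<Longrightarrow> partition_on (insert \<omega> g - {t g}) (P g)"
      by metis
    have "partition_on (\<Union>g\<in>G. insert \<omega> g - {t g}) (\<Union>g\<in>G. P g)"
    proof (rule partition_on_Union)
      fix g h assume gh: "g \<in> G" "h \<in> G" "g \<noteq> h"
      then have "t g = \<omega> \<or> t h = \<omega>"
        using disj[OF gh] by (auto simp: t_def)
      then show "(insert \<omega> g - {t g}) \<inter> (insert \<omega> h - {t h}) = {}"
        using disj[OF gh] inf Z gh by (auto simp: t_def split: if_splits)
    qed (rule P(2))
    moreover have "(\<Union>g\<in>G. insert \<omega> g - {t g}) = insert \<omega> Z - {z}"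
    proof (rule set_eqI)
      fix u
      have "\<exists>g\<in>G. z \<in> g" if "z \<noteq> \<omega>"
        using z that Z by auto
      moreover have "\<omega> \<notin> g" if "g \<in> G" for g
        using inf Z that by auto
      ultimately show "u \<in> (\<Union>g\<in>G. insert \<omega> g - {t g}) \<longleftrightarrow> u \<in> insert \<omega> Z - {z}"
        unfolding Z t_def by (auto split: if_splits)
    qed
    ultimately have "partition_on (insert \<omega> Z - {z}) (\<Union>g\<in>G. P g)"
      by simp
    moreover have "(\<Union>g\<in>G. P g) \<subseteq> (\<Union>g\<in>G. C g)"
      using P(1) by blast
    ultimately show ?thesis
      by (intro exI[of _ "\<Union>g\<in>G. P g"] conjI)
  qed
  moreover have "steiner_triple_system (card Z + 1) (insert \<omega> Z) (D \<union> (\<Union>g\<in>G. C g))"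
    using C by (intro steiner_triple_system_fill[OF gdd inf]) (simp add: almost_parallel_sts_def)
  ultimately show ?thesis
    unfolding almost_parallel_sts_def by (meson le_supI2)
qed

lemma almost_parallel_order_fill:
  fixes Z :: "'a set"
  assumes gdd: "triple_gdd Z G D" and infinite: "infinite (UNIV :: 'a set)"
    and order: "\<And>g. g \<in> G \<Longrightarrow> almost_parallel_order (card g + 1)"
  shows "almost_parallel_order (card Z + 1)"
proof -
  have fin: "finite Z" and part: "partition_on Z G"
    using gdd by (auto simp: triple_gdd_def)
  obtain w where w: "w \<notin> Z"
    using ex_new_if_finite[OF infinite fin] by blast
  have "\<exists>C. almost_parallel_sts (card g + 1) (insert w g) C" if "g \<in> G" for g
  proof (rule almost_parallel_order_on[OF order[OF that]])
    have "g \<subseteq> Z"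
      using partition_onD1[OF part] that by auto
    then show "finite (insert w g)" "card (insert w g) = card g + 1"
      using fin w by (auto simp: finite_subset card_insert_if)
  qed
  then obtain C where "\<And>g. g \<in> G \<Longrightarrow> almost_parallel_sts (card g + 1) (insert w g) (C g)"
    by metis
  then show ?thesis
    by (intro almost_parallel_orderI[OF almost_parallel_sts_fill[OF gdd w]]) blast
qed

section \<open>A group divisible design with three equal groups and a smaller fourth\<close>

text \<open>The point in which the line with parameters \<open>(x, d)\<close> meets group \<open>i\<close>: the first three
  groups carry an arithmetic progression modulo \<open>a\<close>, the fourth its common difference. Making the
  fourth coordinate equal to the parameter \<open>d\<close> turns truncation of that group into the
  condition \<open>d < b\<close>.\<close>
definition line_coord :: "nat \<Rightarrow> nat \<Rightarrow> nat \<Rightarrow> nat \<Rightarrow> nat" where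
  "line_coord a x d i = (if i = 3 then d else (x + i * d) mod a)"

text \<open>The blocks over a line after each of its points is doubled, written as lists of pairs of a group
  and a copy. Over three points they are the graph of exclusive or.\<close>
definition latin_words :: "(nat \<times> bool) list list" where
  "latin_words =
     [[(0, False), (1, False), (2, False)], [(0, False), (1, True), (2, True)],
      [(0, True), (1, False), (2, True)], [(0, True), (1, True), (2, False)]]"

text \<open>Over four points the blocks are the eight lines of the affine plane of order three that avoid the
  origin. The groups 0, 1, 2, 3 stand for the directions \<open>(1,0)\<close>, \<open>(0,1)\<close>, \<open>(1,1)\<close>,
  \<open>(1,2)\<close>, and the second component tells whether the vector is negated. Three distinct vectors form a
  line exactly when their sum is zero.\<close>
definition plane_words :: "(nat \<times> bool) list list" where
  "plane_words =
     [[(0, False), (1, False), (2, True)], [(0, True), (1, True), (2, False)],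
      [(0, False), (1, True), (3, True)], [(0, True), (1, False), (3, False)],
      [(0, False), (2, False), (3, False)], [(0, True), (2, True), (3, True)],
      [(1, False), (2, False), (3, True)], [(1, True), (2, True), (3, False)]]"

text \<open>This turns unique existence over a concrete list into a statement that can be evaluated.\<close>
lemma ex1_if_filter_singleton:
  assumes "length (filter P xs) = 1"
  shows "\<exists>!x. x \<in> set xs \<and> P x"
proof -
  obtain y where y: "filter P xs = [y]"
    using assms by (auto simp: length_Suc_conv)
  have "x \<in> set (filter P xs) \<longleftrightarrow> x = y" for x
    unfolding y by simp
  then have "x \<in> set xs \<and> P x \<longleftrightarrow> x = y" for x
    by simp
  then show ?thesis
    by simp
qed

lemma latin_words_pair:
  assumes "i < 3" "j < 3" "i \<noteq> j"
  shows "\<exists>!w. w \<in> set latin_words \<and> (i, e) \<in> set w \<and> (j, f) \<in> set w"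
proof (rule ex1_if_filter_singleton)
  have all: "\<forall>p\<in>set (List.product [0..<3] [False, True]). \<forall>q\<in>set (List.product [0..<3] [False, True]).
      fst p \<noteq> fst q \<longrightarrow> length (filter (\<lambda>w. p \<in> set w \<and> q \<in> set w) latin_words) = 1"
    by code_simp
  have mem: "(i, e) \<in> set (List.product [0..<3] [False, True])"
    "(j, f) \<in> set (List.product [0..<3] [False, True])"
    using assms by auto
  show "length (filter (\<lambda>w. (i, e) \<in> set w \<and> (j, f) \<in> set w) latin_words) = 1"
    using bspec[OF bspec[OF all mem(1)] mem(2)] assms(3) by simp
qed

lemma plane_words_pair:
  assumes "i < 4" "j < 4" "i \<noteq> j"
  shows "\<exists>!w. w \<in> set plane_words \<and> (i, e) \<in> set w \<and> (j, f) \<in> set w"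
proof (rule ex1_if_filter_singleton)
  have all: "\<forall>p\<in>set (List.product [0..<4] [False, True]). \<forall>q\<in>set (List.product [0..<4] [False, True]).
      fst p \<noteq> fst q \<longrightarrow> length (filter (\<lambda>w. p \<in> set w \<and> q \<in> set w) plane_words) = 1"
    by code_simp
  have mem: "(i, e) \<in> set (List.product [0..<4] [False, True])"
    "(j, f) \<in> set (List.product [0..<4] [False, True])"
    using assms by auto
  show "length (filter (\<lambda>w. (i, e) \<in> set w \<and> (j, f) \<in> set w) plane_words) = 1"
    using bspec[OF bspec[OF all mem(1)] mem(2)] assms(3) by simp
qed

lemma words_shape:
  assumes "w \<in> set latin_words \<or> w \<in> set plane_words"
  shows "card (set w) = 3" "inj_on fst (set w)" "\<forall>(i, e)\<in>set w. i < 4"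
  using assms by (auto simp: latin_words_def plane_words_def)

lemma latin_words_bound: "w \<in> set latin_words \<Longrightarrow> \<forall>(i, e)\<in>set w. i < 3"
  by (auto simp: latin_words_def)

text \<open>Two points in different groups determine the common difference, because the difference of the
  group indices is \<open>1\<close> or \<open>2\<close> up to sign and thus invertible modulo the odd number \<open>a\<close>
  (in the fourth group \<open>d\<close> is read off directly); then they determine \<open>x\<close>.\<close>
lemma line_coord_inj:
  assumes a: "odd a" and ij: "i < 4" "j < 4" "i \<noteq> j"
    and bounds: "x < a" "d < a" "x' < a" "d' < a"
    and eqs: "line_coord a x d i = line_coord a x' d' i"
      "line_coord a x d j = line_coord a x' d' j"
  shows "x = x' \<and> d = d'"
proof -
  have D: "d = d'"
  proof (cases "i = 3 \<or> j = 3")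
    case True
    then show ?thesis
      using eqs by (auto simp: line_coord_def)
  next
    case False
    have "(x + i * d) mod a = (x' + i * d') mod a" "(x + j * d) mod a = (x' + j * d') mod a"
      using eqs False by (auto simp: line_coord_def)
    then have "int ((x + i * d) mod a) = int ((x' + i * d') mod a)"
      "int ((x + j * d) mod a) = int ((x' + j * d') mod a)"
      by (simp_all only:)
    then have "(int x + int i * int d) mod int a = (int x' + int i * int d') mod int a"
      "(int x + int j * int d) mod int a = (int x' + int j * int d') mod int a"
      by (simp_all only: zmod_int of_nat_add of_nat_mult)
    then have e: "int a dvd (int x + int i * int d) - (int x' + int i * int d')"
      "int a dvd (int x + int j * int d) - (int x' + int j * int d')"
      by (simp_all only: mod_eq_dvd_iff)
    have "int a dvd (int i - int j) * (int d - int d')"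
      using dvd_diff[OF e] by (simp add: algebra_simps)
    moreover have "coprime (int a) (int i - int j)"
    proof -
      have "int i - int j \<in> {1, -1, 2, -2}"
        using ij False by auto
      then show ?thesis
        using a by auto
    qed
    ultimately have "int a dvd int d - int d'"
      by (simp add: coprime_dvd_mult_right_iff)
    then have "int d mod int a = int d' mod int a"
      by (simp add: mod_eq_dvd_iff)
    then show ?thesis
      using bounds by simp
  qed
  have "\<exists>c. (x + c) mod a = (x' + c) mod a"
    using eqs ij D by (auto simp: line_coord_def split: if_splits)
  then have "x mod a = x' mod a"
    by (metis cong_add_rcancel_nat cong_def)
  with D bounds show ?thesis
    by simp
qed

text \<open>There are as many lines as pairs of coordinates in groups \<open>i\<close> and \<open>j\<close>, so existence follows
  from uniqueness.\<close>
lemma line_through: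
  assumes a: "odd a" and ij: "i < 4" "j < 4" "i \<noteq> j" and "u < a" "v < a"
  shows "\<exists>x d. x < a \<and> d < a \<and> line_coord a x d i = u \<and> line_coord a x d j = v"
proof -
  let ?A = "{..<a} \<times> {..<a}"
  let ?f = "\<lambda>(x, d). (line_coord a x d i, line_coord a x d j)"
  have "0 < a"
    using \<open>u < a\<close> by simp
  then have "?f ` ?A \<subseteq> ?A"
    by (auto simp: line_coord_def)
  moreover have "inj_on ?f ?A"
    using line_coord_inj[OF a ij] by (auto simp: inj_on_def)
  ultimately have "?f ` ?A = ?A"
    by (intro endo_inj_surj) auto
  then have "(u, v) \<in> ?f ` ?A"
    using assms by auto
  then show ?thesis
    by auto
qed

definition lift_word :: "nat \<Rightarrow> nat \<Rightarrow> nat \<Rightarrow> (nat \<times> bool) list \<Rightarrow> (nat \<times> nat \<times> bool) set" where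
  "lift_word a x d w = (\<lambda>(i, e). (i, line_coord a x d i, e)) ` set w"

definition line_words :: "nat \<Rightarrow> nat \<Rightarrow> (nat \<times> bool) list list" where
  "line_words b d = (if d < b then plane_words else latin_words)"

definition weighted_group :: "nat \<Rightarrow> nat \<Rightarrow> nat \<Rightarrow> (nat \<times> nat \<times> bool) set" where
  "weighted_group a b i = {i} \<times> {..<if i = 3 then b else a} \<times> UNIV"

definition weighted_points :: "nat \<Rightarrow> nat \<Rightarrow> (nat \<times> nat \<times> bool) set" where
  "weighted_points a b = (\<Union>i<4. weighted_group a b i)"

definition weighted_blocks :: "nat \<Rightarrow> nat \<Rightarrow> (nat \<times> nat \<times> bool) set set" where
  "weighted_blocks a b = {lift_word a x d w | x d w. x < a \<and> d < a \<and> w \<in> set (line_words b d)}"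

lemma mem_lift_word:
  "(i, u, e) \<in> lift_word a x d w \<longleftrightarrow> (i, e) \<in> set w \<and> u = line_coord a x d i"
  by (auto simp: lift_word_def)

lemma mem_weighted_points:
  "(i, u, e) \<in> weighted_points a b \<longleftrightarrow> i < 4 \<and> u < (if i = 3 then b else a)"
  by (auto simp: weighted_points_def weighted_group_def)

text \<open>The pair of groups and coordinates picks the line, and over that line the pair of groups and
  copies picks the block.\<close>
lemma weighted_blocks_pair:
  assumes a: "odd a" "b \<le> a"
    and p: "(i, u, e) \<in> weighted_points a b" and q: "(j, v, f) \<in> weighted_points a b" and "i \<noteq> j"
  shows "\<exists>!c. c \<in> weighted_blocks a b \<and> (i, u, e) \<in> c \<and> (j, v, f) \<in> c"
proof -
  have ij: "i < 4" "j < 4" and uv: "u < a" "v < a"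
    using p q a(2) by (auto simp: mem_weighted_points split: if_splits)
  obtain x d where xd: "x < a" "d < a" "line_coord a x d i = u" "line_coord a x d j = v"
    using line_through[OF a(1) ij \<open>i \<noteq> j\<close> uv] by blast
  have "\<exists>!w. w \<in> set (line_words b d) \<and> (i, e) \<in> set w \<and> (j, f) \<in> set w"
  proof (cases "d < b")
    case True
    then show ?thesis
      using plane_words_pair[OF ij \<open>i \<noteq> j\<close>] by (simp add: line_words_def)
  next
    case False
    then have "i \<noteq> 3" "j \<noteq> 3"
      using xd p q by (auto simp: line_coord_def mem_weighted_points)
    then show ?thesis
      using latin_words_pair[of i j e f] ij \<open>i \<noteq> j\<close> False by (simp add: line_words_def)
  qed
  then obtain w where w: "w \<in> set (line_words b d)" "(i, e) \<in> set w" "(j, f) \<in> set w"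
    and uniq: "\<And>w'. w' \<in> set (line_words b d) \<Longrightarrow> (i, e) \<in> set w' \<Longrightarrow> (j, f) \<in> set w' \<Longrightarrow> w' = w"
    by blast
  show ?thesis
  proof (rule ex1I[of _ "lift_word a x d w"])
    show "lift_word a x d w \<in> weighted_blocks a b \<and> (i, u, e) \<in> lift_word a x d w \<and> (j, v, f) \<in> lift_word a x d w"
      using w xd by (auto simp: weighted_blocks_def mem_lift_word)
  next
    fix c assume c: "c \<in> weighted_blocks a b \<and> (i, u, e) \<in> c \<and> (j, v, f) \<in> c"
    then obtain x' d' w' where c': "x' < a" "d' < a" "w' \<in> set (line_words b d')" "c = lift_word a x' d' w'"
      by (auto simp: weighted_blocks_def)
    then have on: "(i, e) \<in> set w'" "(j, f) \<in> set w'"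
      "u = line_coord a x' d' i" "v = line_coord a x' d' j"
      using c by (simp_all add: mem_lift_word)
    have eq: "x' = x \<and> d' = d"
      using line_coord_inj[OF a(1) ij \<open>i \<noteq> j\<close> c'(1,2) xd(1,2)] on(3,4) xd(3,4) by simp
    then show "c = lift_word a x d w"
      using uniq[of w'] on(1,2) c'(3,4) by simp
  qed
qed

lemma weighted_blocks_block:
  assumes "b \<le> a" "c \<in> weighted_blocks a b"
  shows "c \<subseteq> weighted_points a b" "card c = 3" "inj_on fst c"
proof -
  obtain x d w where c: "x < a" "d < a" "w \<in> set (line_words b d)" "c = lift_word a x d w"
    using assms by (auto simp: weighted_blocks_def)
  have w: "w \<in> set latin_words \<or> w \<in> set plane_words"
    using c(3) by (auto simp: line_words_def split: if_splits)
  show "inj_on fst c"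
  proof (rule inj_onI)
    fix p q assume "p \<in> c" "q \<in> c" "fst p = fst q"
    then obtain i e f where "p = (i, line_coord a x d i, e)" "q = (i, line_coord a x d i, f)"
      "(i, e) \<in> set w" "(i, f) \<in> set w"
      by (auto simp: c(4) lift_word_def)
    then show "p = q"
      using inj_onD[OF words_shape(2)[OF w], of "(i, e)" "(i, f)"] by simp
  qed
  have "inj_on (\<lambda>(i, e). (i, line_coord a x d i, e)) (set w)"
    by (auto simp: inj_on_def)
  then show "card c = 3"
    using words_shape(1)[OF w] c(4) by (simp add: lift_word_def card_image)
  show "c \<subseteq> weighted_points a b"
  proof safe
    fix i u e assume m: "(i, u, e) \<in> c"
    then have iw: "(i, e) \<in> set w" "u = line_coord a x d i"
      using c(4) by (auto simp: mem_lift_word)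
    have "i < 4"
      using words_shape(3)[OF w] iw by auto
    moreover have "d < b" if "i = 3"
      using latin_words_bound[of w] iw that c(3) by (auto simp: line_words_def split: if_splits)
    ultimately show "(i, u, e) \<in> weighted_points a b"
      using iw(2) c(1,2) by (auto simp: mem_weighted_points line_coord_def)
  qed
qed

lemma triple_gdd_weighted:
  assumes "odd a" "b \<le> a"
  shows "triple_gdd (weighted_points a b) (weighted_group a b ` {..<4} - {{}}) (weighted_blocks a b)"
proof -
  \<comment> \<open>For \<open>b = 0\<close> the fourth group is empty and must not count as a group.\<close>
  let ?G = "weighted_group a b ` {..<4} - {{}}"
  have "finite (weighted_points a b)"
    by (auto simp: weighted_points_def weighted_group_def)
  moreover have "partition_on (weighted_points a b) ?G"
    by (rule partition_onI) (auto simp: weighted_points_def weighted_group_def disjnt_def)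
  moreover have "if \<exists>g\<in>?G. p \<in> g \<and> q \<in> g then \<not> (\<exists>c\<in>weighted_blocks a b. p \<in> c \<and> q \<in> c)
      else \<exists>!c. c \<in> weighted_blocks a b \<and> p \<in> c \<and> q \<in> c"
    if pq: "p \<in> weighted_points a b" "q \<in> weighted_points a b" "p \<noteq> q" for p q
  proof -
    obtain i u e j v f where p: "p = (i, u, e)" and q: "q = (j, v, f)"
      by (metis prod_cases3)
    have same: "(\<exists>g\<in>?G. p \<in> g \<and> q \<in> g) \<longleftrightarrow> i = j"
      using pq(1,2) unfolding p q by (auto simp: weighted_points_def weighted_group_def)
    show ?thesis
    proof (cases "i = j")
      case True
      then have "\<not> (\<exists>c\<in>weighted_blocks a b. p \<in> c \<and> q \<in> c)"
        using inj_onD[OF weighted_blocks_block(3)[OF assms(2)], of _ p q] pq(3) p q by auto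
      moreover have "\<exists>g\<in>?G. p \<in> g \<and> q \<in> g"
        using same True by blast
      ultimately show ?thesis
        by (subst if_P)
    next
      case False
      then have "\<exists>!c. c \<in> weighted_blocks a b \<and> p \<in> c \<and> q \<in> c"
        using weighted_blocks_pair[OF assms] pq(1,2) unfolding p q by blast
      moreover have "\<not> (\<exists>g\<in>?G. p \<in> g \<and> q \<in> g)"
        using same False by blast
      ultimately show ?thesis
        by (subst if_not_P)
    qed
  qed
  ultimately show ?thesis
    unfolding triple_gdd_def using weighted_blocks_block(1,2)[OF assms(2)] by (intro conjI ballI impI)
qed

text \<open>The factor 3 in \<open>a = 3 * m\<close> and \<open>b = 3 * r\<close>, together with the doubling of points, makes all
  group sizes multiples of 6, so that every filled group again has an order of the required form.\<close>
lemma almost_parallel_order_step: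
  assumes "odd m" and mo: "almost_parallel_order (6 * m + 1)"
    and r: "r \<le> m" "r = 0 \<or> almost_parallel_order (6 * r + 1)"
  shows "almost_parallel_order (6 * (3 * m + r) + 1)"
proof -
  let ?a = "3 * m" and ?b = "3 * r"
  have gdd: "triple_gdd (weighted_points ?a ?b) (weighted_group ?a ?b ` {..<4} - {{}}) (weighted_blocks ?a ?b)"
    using assms by (intro triple_gdd_weighted) auto
  have card_group: "card (weighted_group ?a ?b i) = (if i = 3 then 6 * r else 6 * m)" for i
    by (simp add: weighted_group_def card_cartesian_product)
  have "card (weighted_points ?a ?b) = (\<Sum>i<4. card (weighted_group ?a ?b i))"
    unfolding weighted_points_def by (rule card_UN_disjoint) (auto simp: weighted_group_def)
  also have "\<dots> = 6 * (3 * m + r)"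
  proof -
    have "{..<4::nat} = {0, 1, 2, 3}"
      by auto
    then show ?thesis
      by (simp only: card_group) simp
  qed
  finally have "card (weighted_points ?a ?b) = 6 * (3 * m + r)" .
  moreover have "almost_parallel_order (card g + 1)" if "g \<in> weighted_group ?a ?b ` {..<4} - {{}}" for g
  proof -
    obtain i where i: "g = weighted_group ?a ?b i" "g \<noteq> {}"
      using \<open>g \<in> _\<close> by auto
    have "r \<noteq> 0" if "i = 3"
      using i that by (auto simp: weighted_group_def)
    then show ?thesis
      using mo r(2) by (auto simp: i(1) card_group)
  qed
  moreover have "infinite (UNIV :: (nat \<times> nat \<times> bool) set)"
    by (simp add: finite_prod)
  ultimately show ?thesis
    using almost_parallel_order_fill[OF gdd] by metis
qed

section \<open>Cyclic systems with an almost parallel class\<close>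

text \<open>A base block \<open>{0, a, c}\<close> is given by the pair \<open>d = (a, c)\<close>; its corners are numbered 0, 1, 2 so
  that its ordered differences can be indexed by pairs of distinct corners.\<close>
definition offset :: "int \<times> int \<Rightarrow> nat \<Rightarrow> int" where
  "offset d p = (if p = 0 then 0 else if p = 1 then fst d else snd d)"

definition cyclic_block :: "int \<Rightarrow> int \<Rightarrow> int \<times> int \<Rightarrow> int list" where
  "cyclic_block n s d = map (\<lambda>p. (s + offset d p) mod n) [0, 1, 2]"

definition cyclic_blocks :: "int \<Rightarrow> (int \<times> int) list \<Rightarrow> int set set" where
  "cyclic_blocks n D = {set (cyclic_block n s d) | s d. d \<in> set D}"

definition corner_pairs :: "(nat \<times> nat) list" where
  "corner_pairs = [(0, 1), (0, 2), (1, 0), (1, 2), (2, 0), (2, 1)]"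

definition difference :: "int \<Rightarrow> (int \<times> int) \<times> nat \<times> nat \<Rightarrow> int" where
  "difference n = (\<lambda>(d, p, q). (offset d q - offset d p) mod n)"

text \<open>Each nonzero residue occurs exactly once as a difference. The sorted list contains both parts of
  this claim and can be compared by evaluation.\<close>
definition difference_family :: "int \<Rightarrow> (int \<times> int) list \<Rightarrow> bool" where
  "difference_family n D \<longleftrightarrow>
     n = 6 * int (length D) + 1 \<and>
     sort (map (difference n) (List.product D corner_pairs)) = [1..n - 1]"

text \<open>An entry \<open>(s, d)\<close> of \<open>A\<close> stands for the base block \<open>d\<close> translated by \<open>s\<close>; the class
  covers everything but 0.\<close>
definition almost_parallel_class :: "int \<Rightarrow> (int \<times> int) list \<Rightarrow> (int \<times> int \<times> int) list \<Rightarrow> bool" where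
  "almost_parallel_class n D A \<longleftrightarrow>
     set (map snd A) \<subseteq> set D \<and>
     sort (concat (map (\<lambda>(s, d). cyclic_block n s d) A)) = [1..n - 1]"

lemma mem_cyclic_block:
  "x \<in> set (cyclic_block n s d) \<longleftrightarrow> (\<exists>p<3. x = (s + offset d p) mod n)"
proof -
  have "(\<exists>p<3. x = (s + offset d p) mod n) \<longleftrightarrow> (\<exists>p\<in>{0, 1, 2}. x = (s + offset d p) mod n)"
    by (rule bex_cong[THEN trans[rotated], of "{..<3}"]) auto
  then show ?thesis
    by (auto simp: cyclic_block_def)
qed

lemma set_corner_pairs: "(p, q) \<in> set corner_pairs \<longleftrightarrow> p < 3 \<and> q < 3 \<and> p \<noteq> q"
  by (auto simp: corner_pairs_def)

lemma cyclic_block_cong: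
  assumes "s mod n = t mod n"
  shows "cyclic_block n s d = cyclic_block n t d"
proof -
  have "(s + r) mod n = (t + r) mod n" for r
    using assms by (metis mod_add_left_eq)
  then show ?thesis
    by (simp add: cyclic_block_def)
qed

lemma cyclic_block_shift:
  "(\<lambda>y. (y + x) mod n) ` set (cyclic_block n s d) = set (cyclic_block n (s + x) d)"
proof -
  have "((s + r) mod n + x) mod n = (s + x + r) mod n" for r
    by (simp add: mod_simps algebra_simps)
  then show ?thesis
    by (simp add: cyclic_block_def)
qed

lemma difference_eq:
  assumes "x = (s + offset d p) mod n" "y = (s + offset d q) mod n"
  shows "difference n (d, p, q) = (y - x) mod n"
  unfolding assms difference_def by (simp add: mod_simps)

text \<open>There are at most \<open>6 * length D\<close> choices of a base block and two of its corners, and they yield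
  just as many differences, so no difference is repeated.\<close>
lemma difference_family_bij:
  assumes "difference_family n D"
  shows "bij_betw (difference n) (set D \<times> set corner_pairs) {1..n - 1}"
proof -
  let ?I = "set D \<times> set corner_pairs"
  have "set (map (difference n) (List.product D corner_pairs)) = {1..n - 1}"
    using assms by (metis difference_family_def set_sort set_upto)
  then have im: "difference n ` ?I = {1..n - 1}"
    by simp
  have "card ?I \<le> 6 * length D"
    using card_length[of D] by (simp add: card_cartesian_product corner_pairs_def)
  moreover have "card {1..n - 1} = 6 * length D"
    using assms by (simp add: difference_family_def)
  moreover have "card (difference n ` ?I) \<le> card ?I"
    by (rule card_image_le) simp
  ultimately have "card (difference n ` ?I) = card ?I"
    using im by simp
  then have "inj_on (difference n) ?I"
    by (intro eq_card_imp_inj_on) auto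
  then show ?thesis
    using im by (simp add: bij_betw_def)
qed

text \<open>The difference \<open>y - x\<close> determines the base block and the corners that \<open>x\<close> and \<open>y\<close> occupy;
  the position of \<open>x\<close> then determines the translation.\<close>
lemma cyclic_block_pair:
  assumes df: "difference_family n D" and xy: "x \<in> {0..<n}" "y \<in> {0..<n}" "x \<noteq> y"
  shows "\<exists>!b. b \<in> cyclic_blocks n D \<and> x \<in> b \<and> y \<in> b"
proof -
  have bij: "bij_betw (difference n) (set D \<times> set corner_pairs) {1..n - 1}"
    using df by (rule difference_family_bij)
  have "(y - x) mod n \<noteq> 0"
  proof
    assume "(y - x) mod n = 0"
    then have "y mod n = x mod n"
      by (simp only: mod_eq_dvd_iff mod_eq_0_iff_dvd)
    moreover have "x mod n = x" "y mod n = y"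
      using xy(1,2) by simp_all
    ultimately show False
      using xy(3) by metis
  qed
  moreover have "0 \<le> (y - x) mod n" "(y - x) mod n < n"
    using xy by auto
  ultimately have "(y - x) mod n \<in> {1..n - 1}"
    unfolding atLeastAtMost_iff by linarith
  then have "(y - x) mod n \<in> difference n ` (set D \<times> set corner_pairs)"
    by (simp only: bij_betw_imp_surj_on[OF bij])
  then obtain d p q where d: "d \<in> set D" "(p, q) \<in> set corner_pairs"
    and diff: "difference n (d, p, q) = (y - x) mod n"
    by auto
  define s where "s = x - offset d p"
  have sx: "x = (s + offset d p) mod n"
    using xy by (simp add: s_def)
  have "(s + offset d q) mod n = (x + (offset d q - offset d p) mod n) mod n"
    by (simp add: s_def mod_simps algebra_simps)
  also have "\<dots> = (x + (y - x) mod n) mod n"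
    using diff by (simp add: difference_def)
  also have "\<dots> = y"
    using xy by (simp add: mod_simps)
  finally have sy: "y = (s + offset d q) mod n"
    by simp
  show ?thesis
  proof (rule ex1I[of _ "set (cyclic_block n s d)"])
    have "set (cyclic_block n s d) \<in> cyclic_blocks n D"
      unfolding cyclic_blocks_def using d(1) by blast
    moreover have "p < 3" "q < 3"
      using d(2) by (simp_all add: set_corner_pairs)
    then have "x \<in> set (cyclic_block n s d)" "y \<in> set (cyclic_block n s d)"
      unfolding mem_cyclic_block using sx sy by blast+
    ultimately show "set (cyclic_block n s d) \<in> cyclic_blocks n D \<and>
        x \<in> set (cyclic_block n s d) \<and> y \<in> set (cyclic_block n s d)"
      by blast
  next
    fix b assume b: "b \<in> cyclic_blocks n D \<and> x \<in> b \<and> y \<in> b"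
    then obtain t e where e: "e \<in> set D" "b = set (cyclic_block n t e)"
      unfolding cyclic_blocks_def by blast
    then obtain p' q' where pq: "p' < 3" "q' < 3" "x = (t + offset e p') mod n" "y = (t + offset e q') mod n"
      using b mem_cyclic_block[of x n t e] mem_cyclic_block[of y n t e] by blast
    then have "(p', q') \<in> set corner_pairs"
      using xy(3) unfolding set_corner_pairs by metis
    moreover have "difference n (e, p', q') = difference n (d, p, q)"
      using difference_eq[OF pq(3,4)] diff by simp
    ultimately have "(e, p', q') = (d, p, q)"
      using inj_onD[OF bij_betw_imp_inj_on[OF bij]] d e(1) by blast
    then have "(t + offset d p) mod n = (s + offset d p) mod n"
      using pq(3) sx by simp
    then have "t mod n = s mod n"
      by (simp add: mod_eq_dvd_iff)
    then have "cyclic_block n t d = cyclic_block n s d"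
      by (rule cyclic_block_cong)
    then show "b = set (cyclic_block n s d)"
      using e(2) \<open>(e, p', q') = (d, p, q)\<close> by simp
  qed
qed

text \<open>Two coinciding corners would give the difference 0, which does not occur in the family.\<close>
lemma cyclic_block_card:
  assumes "difference_family n D" and "d \<in> set D"
  shows "card (set (cyclic_block n s d)) = 3"
proof -
  have "(s + offset d p) mod n \<noteq> (s + offset d q) mod n" if "(p, q) \<in> set corner_pairs" for p q
  proof
    assume "(s + offset d p) mod n = (s + offset d q) mod n"
    then have "difference n (d, p, q) = 0"
      using difference_eq[OF refl refl, of n d p q s] by simp
    moreover have "difference n (d, p, q) \<in> {1..n - 1}"
      using bij_betwE[OF difference_family_bij[OF assms(1)]] assms(2) that by auto
    ultimately show False
      by simp
  qed
  from this[of 0 1] this[of 0 2] this[of 1 2] show ?thesis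
    by (simp add: cyclic_block_def corner_pairs_def)
qed

lemma partition_on_concat:
  assumes "distinct (concat xss)" and "[] \<notin> set xss"
  shows "partition_on (set (concat xss)) (set ` set xss)"
  using assms
proof (induction xss)
  case (Cons xs xss)
  have disj: "disjnt (set xs) (\<Union>(set ` set xss))"
    using Cons.prems by (auto simp: disjnt_def)
  have "set (concat (xs # xss)) - set xs = set (concat xss)"
    using Cons.prems by auto
  then show ?case
    using Cons partition_on_insert[OF disj, of "set (concat (xs # xss))"] by auto
qed (simp add: partition_on_empty)

text \<open>Translation by \<open>x\<close> permutes the blocks and carries the given class, which misses 0, to one that
  misses \<open>x\<close>.\<close>
lemma cyclic_almost_parallel_sts:
  assumes df: "difference_family n D" and apc: "almost_parallel_class n D A"
  shows "almost_parallel_sts (nat n) {0..<n} (cyclic_blocks n D)"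
proof -
  have n: "0 < n"
    using df by (simp add: difference_family_def)
  have sts: "steiner_triple_system (nat n) {0..<n} (cyclic_blocks n D)"
    unfolding steiner_triple_system_def
  proof (intro conjI ballI impI)
    fix b assume "b \<in> cyclic_blocks n D"
    then obtain s d where "d \<in> set D" "b = set (cyclic_block n s d)"
      unfolding cyclic_blocks_def by blast
    then show "b \<subseteq> {0..<n}" "card b = 3"
      using n cyclic_block_card[OF df] by (auto simp: cyclic_block_def)
  qed (use cyclic_block_pair[OF df] in simp_all)
  let ?xss = "map (\<lambda>(s, d). cyclic_block n s d) A"
  have "sort (concat ?xss) = [1..n - 1]"
    using apc by (simp add: almost_parallel_class_def)
  then have "distinct (concat ?xss)" "set (concat ?xss) = {1..n - 1}"
    by (metis distinct_sort distinct_upto, metis set_sort set_upto)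
  moreover have "[] \<notin> set ?xss"
    by (auto simp: cyclic_block_def)
  ultimately have P: "partition_on {1..n - 1} (set ` set ?xss)"
    using partition_on_concat by metis
  have P_shift: "(\<lambda>y. (y + x) mod n) ` b \<in> cyclic_blocks n D" if "b \<in> set ` set ?xss" for b x
  proof -
    have "b \<in> (\<lambda>a. set (cyclic_block n (fst a) (snd a))) ` set A"
      using that by (simp add: image_image case_prod_beta)
    then obtain a where a: "a \<in> set A" "b = set (cyclic_block n (fst a) (snd a))"
      by blast
    then have "snd a \<in> set D"
      using apc by (auto simp: almost_parallel_class_def)
    then show ?thesis
      unfolding a(2) cyclic_block_shift cyclic_blocks_def by blast
  qed
  have "\<exists>Q\<subseteq>cyclic_blocks n D. partition_on ({0..<n} - {x}) Q" if x: "x \<in> {0..<n}" for x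
  proof -
    let ?f = "\<lambda>y. (y + x) mod n"
    have inj: "inj_on ?f {0..<n}"
    proof (rule inj_onI)
      fix y z assume yz: "y \<in> {0..<n}" "z \<in> {0..<n}" "(y + x) mod n = (z + x) mod n"
      then have "n dvd y - z"
        by (simp add: mod_eq_dvd_iff)
      then have "y mod n = z mod n"
        by (simp only: mod_eq_dvd_iff)
      moreover have "y mod n = y" "z mod n = z"
        using yz(1,2) by simp_all
      ultimately show "y = z"
        by metis
    qed
    have "?f ` {0..<n} = {0..<n}"
      using n inj by (intro endo_inj_surj) auto
    moreover have "{1..n - 1} = {0..<n} - {0}"
      by auto
    moreover have "?f 0 = x"
      using x by simp
    ultimately have "?f ` {1..n - 1} = {0..<n} - {x}"
      using inj_on_image_set_diff[OF inj, of "{0..<n}" "{0}"] n by simp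
    moreover have "partition_on (?f ` {1..n - 1}) ((`) ?f ` (set ` set ?xss))"
      using inj by (intro partition_on_image[OF P]) (auto intro: inj_on_subset)
    ultimately have "partition_on ({0..<n} - {x}) ((`) ?f ` (set ` set ?xss))"
      by simp
    moreover have "(`) ?f ` (set ` set ?xss) \<subseteq> cyclic_blocks n D"
      using P_shift by (intro image_subsetI)
    ultimately show ?thesis
      by (intro exI[of _ "(`) ?f ` (set ` set ?xss)"] conjI)
  qed
  with sts show ?thesis
    by (simp add: almost_parallel_sts_def)
qed

lemma cyclic_order:
  assumes "difference_family n D" and "almost_parallel_class n D A"
  shows "almost_parallel_order (nat n)"
  using cyclic_almost_parallel_sts[OF assms] by (rule almost_parallel_orderI)

text \<open>The following families were found by a randomised exact cover search: first the base blocks, as a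
  partition of the differences up to sign into triples \<open>u, v, w\<close> with \<open>u + v = w\<close> or
  \<open>u + v + w = n\<close>, then a class of translates that partitions the nonzero residues. They cover the
  values \<open>k = 2, 3, 4, 5, 6, 7, 8, 10, 13, 14, 16, 22\<close>, none of which has the form \<open>3 * m + r\<close>
  with \<open>m \<ge> 3\<close> odd, \<open>r \<le> m\<close> and \<open>r \<noteq> 1\<close>.\<close>
lemma almost_parallel_order_13: "almost_parallel_order 13"
proof -
  let ?D = "[(1, 4), (5, 7)]"
  let ?A = "[(4, 1, 4), (6, 1, 4), (9, 5, 7), (11, 1, 4)]"
  have "difference_family 13 ?D" "almost_parallel_class 13 ?D ?A"
    by code_simp+
  from cyclic_order[OF this] show ?thesis
    by simp
qed

lemma almost_parallel_order_19: "almost_parallel_order 19"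
proof -
  let ?D = "[(3, 7), (5, 6), (8, 10)]"
  let ?A = "[(2, 3, 7), (6, 8, 10), (7, 5, 6), (8, 3, 7), (10, 8, 10), (17, 5, 6)]"
  have "difference_family 19 ?D" "almost_parallel_class 19 ?D ?A"
    by code_simp+
  from cyclic_order[OF this] show ?thesis
    by simp
qed

lemma almost_parallel_order_25: "almost_parallel_order 25"
proof -
  let ?D = "[(3, 10), (4, 12), (5, 6), (9, 11)]"
  let ?A = "[(2, 3, 10), (3, 4, 12), (8, 3, 10), (10, 9, 11), (13, 3, 10), (14, 3, 10), (20, 9, 11), (22, 4, 12)]"
  have "difference_family 25 ?D" "almost_parallel_class 25 ?D ?A"
    by code_simp+
  from cyclic_order[OF this] show ?thesis
    by simp
qed

lemma almost_parallel_order_31: "almost_parallel_order 31"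
proof -
  let ?D = "[(3, 4), (5, 17), (6, 15), (7, 18), (8, 10)]"
  let ?A = "[(1, 8, 10), (2, 6, 15), (3, 7, 18), (5, 8, 10), (6, 8, 10), (7, 5, 17), (18, 5, 17), (19, 8, 10),
            (20, 8, 10), (22, 3, 4)]"
  have "difference_family 31 ?D" "almost_parallel_class 31 ?D ?A"
    by code_simp+
  from cyclic_order[OF this] show ?thesis
    by simp
qed

lemma almost_parallel_order_37: "almost_parallel_order 37"
proof -
  let ?D = "[(3, 16), (6, 10), (7, 18), (8, 9), (12, 14), (15, 20)]"
  let ?A = "[(1, 7, 18), (5, 8, 9), (6, 3, 16), (10, 7, 18), (11, 12, 14), (12, 8, 9), (16, 15, 20), (18, 12, 14),
            (24, 3, 16), (26, 7, 18), (29, 6, 10), (34, 7, 18)]"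
  have "difference_family 37 ?D" "almost_parallel_class 37 ?D ?A"
    by code_simp+
  from cyclic_order[OF this] show ?thesis
    by simp
qed

lemma almost_parallel_order_43: "almost_parallel_order 43"
proof -
  let ?D = "[(1, 21), (2, 11), (7, 13), (8, 24), (10, 14), (12, 17), (15, 18)]"
  let ?A = "[(2, 15, 18), (4, 12, 17), (8, 1, 21), (13, 15, 18), (18, 12, 17), (23, 10, 14), (24, 8, 24),
            (25, 2, 11), (26, 8, 24), (38, 8, 24), (39, 15, 18), (40, 15, 18), (41, 8, 24), (42, 2, 11)]"
  have "difference_family 43 ?D" "almost_parallel_class 43 ?D ?A"
    by code_simp+
  from cyclic_order[OF this] show ?thesis
    by simp
qed

lemma almost_parallel_order_49: "almost_parallel_order 49"
proof -
  let ?D = "[(1, 16), (3, 25), (4, 10), (7, 21), (9, 11), (12, 20), (13, 30), (18, 23)]"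
  let ?A = "[(2, 7, 21), (3, 9, 11), (5, 1, 16), (7, 18, 23), (10, 1, 16), (15, 1, 16), (19, 1, 16), (22, 18, 23),
            (24, 18, 23), (27, 7, 21), (28, 4, 10), (29, 7, 21), (33, 4, 10), (39, 18, 23), (41, 3, 25),
            (46, 7, 21)]"
  have "difference_family 49 ?D" "almost_parallel_class 49 ?D ?A"
    by code_simp+
  from cyclic_order[OF this] show ?thesis
    by simp
qed

lemma almost_parallel_order_61: "almost_parallel_order 61"
proof -
  let ?D = "[(1, 6), (2, 19), (3, 16), (4, 12), (10, 33), (14, 32), (20, 27), (21, 36), (22, 31), (24, 35)]"
  let ?A = "[(3, 2, 19), (10, 1, 6), (13, 14, 32), (14, 14, 32), (17, 1, 6), (21, 4, 12), (26, 4, 12),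
            (29, 22, 31), (31, 4, 12), (32, 21, 36), (34, 24, 35), (36, 3, 16), (37, 10, 33), (40, 2, 19),
            (41, 14, 32), (44, 21, 36), (48, 2, 19), (49, 14, 32), (54, 22, 31), (56, 1, 6)]"
  have "difference_family 61 ?D" "almost_parallel_class 61 ?D ?A"
    by code_simp+
  from cyclic_order[OF this] show ?thesis
    by simp
qed

lemma almost_parallel_order_79: "almost_parallel_order 79"
proof -
  let ?D = "[(1, 36), (2, 9), (5, 20), (10, 40), (12, 41), (13, 24), (16, 33), (18, 32), (19, 23), (21, 27),
            (22, 48), (25, 28), (34, 42)]"
  let ?A = "[(1, 10, 40), (3, 2, 9), (4, 13, 24), (16, 22, 48), (18, 2, 9), (21, 21, 27), (22, 13, 24),
            (29, 34, 42), (30, 1, 36), (34, 2, 9), (37, 13, 24), (39, 1, 36), (44, 18, 32), (45, 12, 41),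
            (47, 5, 20), (49, 19, 23), (51, 34, 42), (53, 1, 36), (55, 18, 32), (56, 18, 32), (58, 1, 36),
            (60, 18, 32), (65, 16, 33), (69, 34, 42), (70, 34, 42), (77, 25, 28)]"
  have "difference_family 79 ?D" "almost_parallel_class 79 ?D ?A"
    by code_simp+
  from cyclic_order[OF this] show ?thesis
    by simp
qed

lemma almost_parallel_order_85: "almost_parallel_order 85"
proof -
  let ?D = "[(6, 45), (8, 9), (10, 13), (11, 23), (14, 35), (15, 31), (19, 37), (20, 22), (24, 53),
            (25, 42), (26, 33), (27, 55), (34, 38), (36, 41)]"
  let ?A = "[(5, 27, 55), (6, 10, 13), (21, 34, 38), (23, 34, 38), (24, 34, 38), (25, 15, 31), (26, 24, 53),
            (29, 6, 45), (30, 8, 9), (34, 19, 37), (37, 15, 31), (41, 24, 53), (42, 25, 42), (43, 6, 45),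
            (44, 25, 42), (45, 19, 37), (46, 24, 53), (47, 25, 42), (48, 6, 45), (51, 36, 41), (63, 10, 13),
            (66, 36, 41), (75, 20, 22), (77, 36, 41), (78, 20, 22), (80, 36, 41), (81, 15, 31), (83, 20, 22)]"
  have "difference_family 85 ?D" "almost_parallel_class 85 ?D ?A"
    by code_simp+
  from cyclic_order[OF this] show ?thesis
    by simp
qed

lemma almost_parallel_order_97: "almost_parallel_order 97"
proof -
  let ?D = "[(1, 23), (4, 10), (5, 32), (7, 19), (9, 24), (13, 51), (14, 31), (20, 45), (21, 47), (28, 44),
            (29, 40), (33, 63), (35, 37), (36, 54), (39, 42), (41, 49)]"
  let ?A = "[(1, 39, 42), (5, 7, 19), (9, 41, 49), (10, 28, 44), (15, 20, 45), (16, 33, 63), (17, 28, 44),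
            (18, 4, 10), (25, 39, 42), (26, 4, 10), (33, 41, 49), (34, 35, 37), (37, 7, 19), (39, 20, 45),
            (41, 36, 54), (42, 41, 49), (46, 9, 24), (47, 39, 42), (48, 20, 45), (51, 41, 49), (52, 13, 51),
            (53, 4, 10), (62, 4, 10), (73, 5, 32), (75, 36, 54), (76, 28, 44), (80, 28, 44), (81, 35, 37),
            (85, 5, 32), (87, 1, 23), (94, 5, 32), (96, 5, 32)]"
  have "difference_family 97 ?D" "almost_parallel_class 97 ?D ?A"
    by code_simp+
  from cyclic_order[OF this] show ?thesis
    by simp
qed

lemma almost_parallel_order_133: "almost_parallel_order 133"
proof -
  let ?D = "[(2, 54), (9, 16), (12, 55), (15, 72), (17, 30), (18, 51), (19, 23), (20, 31), (21, 71),
            (22, 49), (24, 65), (25, 26), (29, 73), (32, 38), (34, 80), (35, 63), (36, 39), (37, 47),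
            (42, 56), (45, 85), (58, 66), (59, 64)]"
  let ?A = "[(6, 12, 55), (8, 37, 47), (11, 25, 26), (12, 29, 73), (22, 42, 56), (26, 17, 30), (32, 2, 54),
            (33, 21, 71), (35, 9, 16), (38, 15, 72), (39, 20, 31), (40, 22, 49), (42, 24, 65), (46, 25, 26),
            (47, 58, 66), (48, 20, 31), (49, 18, 51), (50, 45, 85), (52, 42, 56), (57, 45, 85), (58, 29, 73),
            (60, 24, 65), (63, 59, 64), (65, 15, 72), (69, 19, 23), (74, 58, 66), (75, 15, 72), (76, 45, 85),
            (77, 34, 80), (81, 15, 72), (82, 9, 16), (83, 20, 31), (93, 25, 26), (97, 20, 31), (99, 17, 30),
            (101, 35, 63), (106, 42, 56), (109, 37, 47), (112, 18, 51), (115, 19, 23), (120, 32, 38),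
            (123, 20, 31), (124, 25, 26), (126, 34, 80)]"
  have "difference_family 133 ?D" "almost_parallel_class 133 ?D ?A"
    by code_simp+
  from cyclic_order[OF this] show ?thesis
    by simp
qed

section \<open>Almost parallel classes in all orders above seven\<close>

text \<open>The step needs \<open>k = 3 * m + r\<close> with \<open>m\<close> odd and \<open>r \<le> m\<close>, where \<open>r = 1\<close> is excluded because
  order 7 has no almost parallel classes. Consecutive odd \<open>m\<close> move \<open>3 * m\<close> by 6, so a remainder
  \<open>r\<close> between 2 and 7 can always be chosen; from \<open>k = 23\<close> on this gives \<open>m \<ge> 7 \<ge> r\<close>.\<close>
theorem almost_parallel_order_6k_plus_1:
  assumes "k \<ge> 2"
  shows "almost_parallel_order (6 * k + 1)"
  using assms
proof (induction k rule: less_induct)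
  case (less k)
  have step: "almost_parallel_order (6 * k + 1)"
    if "odd m" "2 \<le> m" "r \<le> m" "r \<noteq> 1" "k = 3 * m + r" for m r
    using less.IH[of m] less.IH[of r] almost_parallel_order_step[of m r] that
    by (cases "r = 0") auto
  show ?case
  proof (cases "k < 23")
    case True
    then have "k \<in> {2, 3, 4, 5, 6, 7, 8, 10, 13, 14, 16, 22} \<or>
        k \<in> {9, 11, 12} \<or> k \<in> {15, 17, 18, 19, 20} \<or> k = 21"
      using less.prems by (auto simp: numeral_eq_Suc less_Suc_eq)
    then show ?thesis
    proof (elim disjE)
      assume "k \<in> {2, 3, 4, 5, 6, 7, 8, 10, 13, 14, 16, 22}"
      then show ?thesis
        using almost_parallel_order_13 almost_parallel_order_19 almost_parallel_order_25
          almost_parallel_order_31 almost_parallel_order_37 almost_parallel_order_43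
          almost_parallel_order_49 almost_parallel_order_61 almost_parallel_order_79
          almost_parallel_order_85 almost_parallel_order_97 almost_parallel_order_133
        by auto
    next
      assume "k \<in> {9, 11, 12}"
      then show ?thesis
        using step[of 3 "k - 9"] by auto
    next
      assume "k \<in> {15, 17, 18, 19, 20}"
      then show ?thesis
        using step[of 5 "k - 15"] by auto
    next
      assume "k = 21"
      then show ?thesis
        using step[of 7 0] by simp
    qed
  next
    case False
    \<comment> \<open>The largest odd number with \<open>3 * m + 2 \<le> k\<close>.\<close>
    define m where "m = 2 * ((k - 5) div 6) + 1"
    have "3 * m + 2 \<le> k" "k < 3 * m + 8" "7 \<le> m"
      using False unfolding m_def by presburger+
    then have "2 \<le> m" "k - 3 * m \<le> m" "k - 3 * m \<noteq> 1" "k = 3 * m + (k - 3 * m)"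
      by linarith+
    moreover have "odd m"
      by (simp add: m_def)
    ultimately show ?thesis
      by (intro step[of m "k - 3 * m"])
  qed
qed

section \<open>Order seven\<close>

lemma block_through:
  assumes sts: "steiner_triple_system n X B" and xy: "x \<in> X" "y \<in> X" "x \<noteq> y"
  obtains z where "{x, y, z} \<in> B" "z \<in> X" "z \<noteq> x" "z \<noteq> y"
proof -
  obtain b where b: "b \<in> B" "x \<in> b" "y \<in> b"
    using steiner_triple_systemD(5)[OF sts xy] by blast
  have "card b = 3" "b \<subseteq> X"
    using steiner_triple_systemD(3,4)[OF sts b(1)] by auto
  then have "card (b - {x, y}) = 1"
    using b xy(3) by (simp add: card_Diff_subset)
  then obtain z where "b - {x, y} = {z}"
    by (rule card_1_singletonE)
  then have "b = {x, y, z}" "z \<noteq> x" "z \<noteq> y"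
    using b by auto
  then show ?thesis
    using that b(1) \<open>b \<subseteq> X\<close> by blast
qed

lemma block_unique:
  assumes "steiner_triple_system n X B" and "b \<in> B" "c \<in> B"
    and "x \<in> b" "y \<in> b" "x \<in> c" "y \<in> c" "x \<noteq> y"
  shows "b = c"
proof -
  have "x \<in> X" "y \<in> X"
    using steiner_triple_systemD(3)[OF assms(1,2)] assms(4,5) by auto
  then show ?thesis
    using steiner_triple_systemD(5)[OF assms(1)] assms(2-) by metis
qed

text \<open>If \<open>p\<close> and \<open>q\<close> were disjoint, only one further point \<open>z\<close> would remain. The block through a point
  \<open>x\<close> of \<open>p\<close> and any point of \<open>q\<close> must then have \<open>z\<close> as its third point, but the pair
  \<open>x, z\<close> lies in only one block.\<close>
lemma blocks_meet_in_order_7: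
  assumes sts: "steiner_triple_system 7 X B" and pq: "p \<in> B" "q \<in> B"
  shows "p \<inter> q \<noteq> {}"
proof
  assume disj: "p \<inter> q = {}"
  have fin: "finite X" "card X = 7"
    using steiner_triple_systemD(1,2)[OF sts] by auto
  have p: "p \<subseteq> X" "card p = 3" and q: "q \<subseteq> X" "card q = 3"
    using steiner_triple_systemD(3,4)[OF sts] pq by auto
  have "card (p \<union> q) = 6"
    using p q disj fin by (subst card_Un_disjoint) (auto intro: finite_subset)
  then have "card (X - (p \<union> q)) = 1"
    using p q fin by (subst card_Diff_subset) (auto intro: finite_subset)
  then obtain z where z: "X - (p \<union> q) = {z}"
    by (rule card_1_singletonE)
  obtain x where x: "x \<in> p"
    using p(2) by fastforce
  have xz: "{x, y, z} \<in> B" if y: "y \<in> q" for y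
  proof -
    have "x \<noteq> y"
      using x y disj by auto
    then obtain w where w: "{x, y, w} \<in> B" "w \<in> X" "w \<noteq> x" "w \<noteq> y"
      using block_through[OF sts] x y p(1) q(1) by blast
    have "w \<notin> p"
      using block_unique[OF sts w(1) pq(1), of x w] x y w disj by auto
    moreover have "w \<notin> q"
      using block_unique[OF sts w(1) pq(2), of y w] x y w disj by auto
    ultimately have "w = z"
      using z w(2) by auto
    then show ?thesis
      using w(1) by simp
  qed
  obtain y y' where y: "y \<in> q" "y' \<in> q" "y \<noteq> y'"
    using q(2) by (metis card_3_iff insertI1 insertI2)
  have "x \<noteq> z"
    using x z by auto
  then have "{x, y, z} = {x, y', z}"
    using block_unique[OF sts xz[OF y(1)] xz[OF y(2)], of x z] by auto
  then have "y' \<in> {x, y, z}"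
    by auto
  then show False
    using y x z disj by auto
qed

text \<open>With blocks \<open>{d, a, a'}\<close>, \<open>{d, b, b'}\<close>, \<open>{d, c, c'}\<close> and \<open>{a, b, c}\<close> the ordering
  \<open>a, b, a', d, b', c, c'\<close> works: any three consecutive terms contain two points of one of
  these blocks but not its third point, hence are not a block themselves.\<close>
lemma sequencing_of_order_7:
  assumes sts: "steiner_triple_system 7 X B"
  obtains xs where "sequencing X xs" "\<And>i. i < 5 \<Longrightarrow> set (take 3 (drop i xs)) \<notin> B"
proof -
  note eq = block_unique[OF sts]
  have fin: "finite X" "card X = 7"
    using steiner_triple_systemD(1,2)[OF sts] by auto
  have ex: "\<exists>x. x \<in> X \<and> x \<notin> S" if "finite S" "card S < 7" for S
  proof (rule ccontr)
    assume "\<not> ?thesis"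
    then have "X \<subseteq> S"
      by auto
    then have "card X \<le> card S"
      by (rule card_mono[OF that(1)])
    then show False
      using that(2) fin(2) by simp
  qed
  obtain d where d: "d \<in> X"
    using ex[of "{}"] by auto
  obtain a where a: "a \<in> X" "a \<noteq> d"
    using ex[of "{d}"] by auto
  obtain a' where a': "{d, a, a'} \<in> B" "a' \<in> X" "a' \<noteq> d" "a' \<noteq> a"
    using block_through[OF sts d a(1)] a(2) by metis
  obtain b where b: "b \<in> X" "b \<notin> {d, a, a'}"
    using ex[of "{d, a, a'}"] a(2) a'(3,4) by (auto simp: card_insert_if)
  obtain b' where b': "{d, b, b'} \<in> B" "b' \<in> X" "b' \<noteq> d" "b' \<noteq> b"
    using block_through[OF sts d b(1)] b(2) by (metis insertCI)
  obtain c where c: "{a, b, c} \<in> B" "c \<in> X" "c \<noteq> a" "c \<noteq> b"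
    using block_through[OF sts a(1) b(1)] b(2) by (metis insertCI)
  have ab': "b' \<noteq> a" "b' \<noteq> a'"
    using eq[OF a'(1) b'(1), of d b'] b b'(3) by auto
  have cd: "c \<noteq> d" "c \<noteq> a'"
    using eq[OF a'(1) c(1), of a c] b c(3) by auto
  have cb': "c \<noteq> b'"
    using eq[OF b'(1) c(1), of b c] a(2) b(2) ab'(1) c(4) by auto
  obtain c' where c': "{d, c, c'} \<in> B" "c' \<in> X" "c' \<noteq> d" "c' \<noteq> c"
    using block_through[OF sts d c(2)] cd(1) by metis
  have ca': "c' \<noteq> a" "c' \<noteq> a'"
    using eq[OF a'(1) c'(1), of d c'] c cd c'(3) by auto
  have cb: "c' \<noteq> b" "c' \<noteq> b'"
    using eq[OF b'(1) c'(1), of d c'] c cd cb' c'(3) by auto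
  let ?xs = "[a, b, a', d, b', c, c']"
  have dist: "distinct ?xs"
    using a a' b b' c c' ab' cd cb' ca' cb by auto
  have "set ?xs \<subseteq> X"
    using a a' b b' c c' d by auto
  then have "set ?xs = X"
    using fin distinct_card[OF dist] by (intro card_subset_eq) auto
  then have seq: "sequencing X ?xs"
    using dist by (simp add: sequencing_def)
  have other: "{x, y, z} \<notin> B" if "{x, y, w} \<in> B" "x \<noteq> y" "z \<notin> {x, y, w}" for x y z w
  proof
    assume "{x, y, z} \<in> B"
    then have "{x, y, z} = {x, y, w}"
      using eq[OF _ that(1), of "{x, y, z}" x y] that(2) by simp
    then show False
      using that(3) by blast
  qed
  have "{a, b, a'} \<notin> B"
    by (rule other[of _ _ c]) (use c(1) dist in auto)
  moreover have "{a', d, b} \<notin> B"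
    by (rule other[of _ _ a]) (use a'(1) dist in \<open>auto simp: insert_commute\<close>)
  moreover have "{a', d, b'} \<notin> B"
    by (rule other[of _ _ a]) (use a'(1) dist in \<open>auto simp: insert_commute\<close>)
  moreover have "{d, b', c} \<notin> B"
    by (rule other[of _ _ b]) (use b'(1) dist in \<open>auto simp: insert_commute\<close>)
  moreover have "{c, c', b'} \<notin> B"
    by (rule other[of _ _ d]) (use c'(1) dist in \<open>auto simp: insert_commute\<close>)
  ultimately have no: "{a, b, a'} \<notin> B" "{b, a', d} \<notin> B" "{a', d, b'} \<notin> B"
      "{d, b', c} \<notin> B" "{b', c, c'} \<notin> B"
    by (simp_all add: insert_commute)
  have "set (take 3 (drop i ?xs)) \<notin> B" if "i < 5" for i
  proof -
    have "i = 0 \<or> i = 1 \<or> i = 2 \<or> i = 3 \<or> i = 4"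
      using that by auto
    then show ?thesis
      using no by (elim disjE) simp_all
  qed
  with seq show ?thesis
    by (rule that)
qed

lemma card_partition_into_blocks:
  assumes sts: "steiner_triple_system n X B" and "P \<subseteq> B" "partition_on S P" "finite S"
  shows "card S = 3 * card P"
proof -
  have c: "card b = 3" if "b \<in> P" for b
    using steiner_triple_systemD(4)[OF sts] assms(2) that by auto
  then have "finite b" if "b \<in> P" for b
    using that by (metis card.infinite zero_neq_numeral)
  then have "card (\<Union>P) = sum card P"
    using partition_onD2[OF assms(3)] by (intro card_Union_disjoint)
  also have "\<dots> = 3 * card P"
    using c by simp
  finally show ?thesis
    using partition_onD1[OF assms(3)] by simp
qed

lemma sequenceable_order_7:
  assumes sts: "steiner_triple_system 7 X B"
  shows "sequenceable X B"
proof -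
  obtain xs where seq: "sequencing X xs" and no: "\<And>i. i < 5 \<Longrightarrow> set (take 3 (drop i xs)) \<notin> B"
    using sequencing_of_order_7[OF sts] by blast
  have dist: "distinct xs" and X: "set xs = X"
    using seq by (auto simp: sequencing_def)
  have len: "length xs = 7"
    using distinct_card[OF dist] X steiner_triple_systemD(2)[OF sts] by simp
  have "\<not> partitionable_into_blocks B ys" if seg: "proper_segment ys xs" for ys
  proof
    assume "partitionable_into_blocks B ys"
    then obtain P where P: "P \<subseteq> B" "partition_on (set ys) P"
      by (auto simp: partitionable_into_blocks_def)
    obtain us vs where xs: "xs = us @ ys @ vs" and ne: "ys \<noteq> []" "ys \<noteq> xs"
      using seg by (auto simp: proper_segment_def strict_sublist_def sublist_def)
    have "length ys = card (set ys)"
      using dist xs by (simp add: distinct_card)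
    then have ys3: "length ys = 3 * card P"
      using card_partition_into_blocks[OF sts P] by simp
    have sum: "length us + length ys + length vs = 7"
      using xs len by simp
    have "length us + length vs > 0" "length ys > 0"
      using xs ne by auto
    with sum have lens: "length us + length ys + length vs = 7" "length ys < 7" "length ys > 0"
      by linarith+
    then have "card P = 1 \<or> card P = 2"
      using ys3 by auto
    then show False
    proof
      assume "card P = 1"
      then obtain p where "P = {p}"
        by (rule card_1_singletonE)
      then have "set ys \<in> B"
        using P partition_onD1[OF P(2)] by simp
      moreover have "ys = take 3 (drop (length us) xs)"
        using xs ys3 \<open>card P = 1\<close> by simp
      ultimately show False
        using no[of "length us"] lens ys3 \<open>card P = 1\<close> by simp
    next
      assume "card P = 2"
      then obtain p q where "P = {p, q}" "p \<noteq> q"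
        by (auto simp: card_2_iff)
      then show False
        using blocks_meet_in_order_7[OF sts, of p q] P(1) partition_onD2[OF P(2)]
        by (auto simp: disjoint_def)
    qed
  qed
  then show ?thesis
    using seq by (auto simp: sequenceable_def admissible_def)
qed

section \<open>The spectrum of nonsequenceable systems\<close>

theorem theorem3p1:
  shows "(\<forall>n::nat. [n = 1] (mod 6) \<and> n > 1 \<and> n \<noteq> 7 \<longrightarrow>
            (\<exists>(X :: nat set) B. steiner_triple_system n X B \<and> nonsequenceable X B)) \<and>
         \<not> (\<exists>(Y :: 'a set) C. steiner_triple_system 7 Y C \<and> nonsequenceable Y C)"
proof (intro conjI allI impI)
  fix n :: nat
  assume n: "[n = 1] (mod 6) \<and> n > 1 \<and> n \<noteq> 7"
  then have "n = 6 * (n div 6) + 1" "n div 6 \<ge> 2"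
    unfolding cong_def by presburger+
  then obtain X :: "nat set" and B where "almost_parallel_sts n X B"
    using almost_parallel_order_6k_plus_1[of "n div 6"]
    by (metis almost_parallel_order_def)
  then show "\<exists>(X :: nat set) B. steiner_triple_system n X B \<and> nonsequenceable X B"
    using nonsequenceable_if_almost_parallel n by (metis almost_parallel_sts_def)
next
  show "\<not> (\<exists>(Y :: 'a set) C. steiner_triple_system 7 Y C \<and> nonsequenceable Y C)"
    using sequenceable_order_7 by blast
qed

end
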